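(* Let $n \ge 2$ be an integer. For any finite $n$-player game $G$ and any polytope $P \subset \mathbb{R}^n$ with $CEP(G) \subset P$, there exists a finite $n$-player game $G'$ such that $NEP(G') = NEP(G)$ and $CEP(G') = P$.
   Context: A polytope in $\mathbb{R}^n$ is the convex hull of a finite set of points. A (finite) $n$-player game $G$ consists of a nonempty finite pure strategy set $S_i$ and a payoff function $u_i : S := S_1 \times \cdots \times S_n \to \mathbb{R}$ for each player $i \in \{1,\dots,n\}$. Write $S_{-i} := \prod_{j \ne i} S_j$. A correlated equilibrium of $G$ is a probability distribution $\mu$ on $S$ such that for every player $i$ and all $s_i, t_i \in S_i$, $\sum_{s_{-i} \in S_{-i}} \mu(s_i,s_{-i})\,[u_i(s_i,s_{-i}) - u_i(t_i,s_{-i})] \ge 0$. For a probability distribution $\mu$ on $S$, $u_i(\mu) := \sum_{s \in S} \mu(s) u_i(s)$. $CEP(G) \subset \mathbb{R}^n$ denotes the set of all vectors $(u_1(\mu),\dots,u_n(\mu))$ where $\mu$ is a correlated equilibrium of $G$. $NEP(G) \subset \mathbb{R}^n$ denotes the set of all vectors of expected payoffs of (mixed) Nash equilibria of $G$. *)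

theory Defs
  imports "HOL-Analysis.Analysis" "HOL-Probability.Probability"
begin

text \<open>
  The players are the elements of the finite type \<open>'n\<close>, so payoff vectors live in
  \<open>real ^ 'n\<close>. The strategy sets of all players are subsets of one common type \<open>'a\<close>;
  this is no restriction, since the sets are indexed by the player. The payoff functions are
  total, but only their values on \<open>profiles G\<close> matter.
\<close>

record ('n, 'a) game =
  strats :: "'n \<Rightarrow> 'a set"
  payoff :: "'n \<Rightarrow> ('n \<Rightarrow> 'a) \<Rightarrow> real"

definition finite_game :: "('n::finite, 'a) game \<Rightarrow> bool" where
  "finite_game G \<longleftrightarrow> (\<forall>i. finite (strats G i) \<and> strats G i \<noteq> {})"

definition profiles :: "('n::finite, 'a) game \<Rightarrow> ('n \<Rightarrow> 'a) set" where
  "profiles G = PiE UNIV (strats G)"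

text \<open>
  An opponent profile is a function on the players other than \<open>i\<close> (with the value
  \<open>undefined\<close> at \<open>i\<close>); the full profile $(a, r)$ is \<open>r(i := a)\<close>.
\<close>

definition opp_profiles :: "('n::finite, 'a) game \<Rightarrow> 'n \<Rightarrow> ('n \<Rightarrow> 'a) set" where
  "opp_profiles G i = PiE (UNIV - {i}) (strats G)"

definition exp_payoff :: "('n::finite, 'a) game \<Rightarrow> 'n \<Rightarrow> ('n \<Rightarrow> 'a) pmf \<Rightarrow> real" where
  "exp_payoff G i \<mu> = (\<Sum>s\<in>profiles G. pmf \<mu> s * payoff G i s)"

definition payoff_vec :: "('n::finite, 'a) game \<Rightarrow> ('n \<Rightarrow> 'a) pmf \<Rightarrow> real ^ 'n" where
  "payoff_vec G \<mu> = (\<chi> i. exp_payoff G i \<mu>)"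

definition correlated_eq :: "('n::finite, 'a) game \<Rightarrow> ('n \<Rightarrow> 'a) pmf \<Rightarrow> bool" where
  "correlated_eq G \<mu> \<longleftrightarrow>
     set_pmf \<mu> \<subseteq> profiles G \<and>
     (\<forall>i. \<forall>a\<in>strats G i. \<forall>b\<in>strats G i.
        (\<Sum>r\<in>opp_profiles G i.
           pmf \<mu> (r(i := a)) * (payoff G i (r(i := a)) - payoff G i (r(i := b)))) \<ge> 0)"

definition mixed_profile :: "('n::finite, 'a) game \<Rightarrow> ('n \<Rightarrow> 'a pmf) \<Rightarrow> bool" where
  "mixed_profile G \<sigma> \<longleftrightarrow> (\<forall>i. set_pmf (\<sigma> i) \<subseteq> strats G i)"

text \<open>
  The distribution on profiles when the players randomize independently. The default value
  \<open>undefined\<close> is never used, as the index set is \<open>UNIV\<close>.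
\<close>

definition induced_dist :: "('n::finite \<Rightarrow> 'a pmf) \<Rightarrow> ('n \<Rightarrow> 'a) pmf" where
  "induced_dist \<sigma> = Pi_pmf UNIV undefined \<sigma>"

definition nash_eq :: "('n::finite, 'a) game \<Rightarrow> ('n \<Rightarrow> 'a pmf) \<Rightarrow> bool" where
  "nash_eq G \<sigma> \<longleftrightarrow>
     mixed_profile G \<sigma> \<and>
     (\<forall>i \<tau>. set_pmf \<tau> \<subseteq> strats G i \<longrightarrow>
        exp_payoff G i (induced_dist (\<sigma>(i := \<tau>))) \<le> exp_payoff G i (induced_dist \<sigma>))"

definition CEP :: "('n::finite, 'a) game \<Rightarrow> (real ^ 'n) set" where
  "CEP G = {payoff_vec G \<mu> | \<mu>. correlated_eq G \<mu>}"

definition NEP :: "('n::finite, 'a) game \<Rightarrow> (real ^ 'n) set" where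
  "NEP G = {payoff_vec G (induced_dist \<sigma>) | \<sigma>. nash_eq G \<sigma>}"

end

theory Submission
  imports Defs
begin

text \<open>
  Write \<open>P\<close> as the convex hull of a finite set \<open>X\<close>. For every \<open>x \<in> X\<close> two players \<open>p\<close> and \<open>q\<close> get three
  additional strategies each, the block of \<open>x\<close>. If both of them play in it, every player \<open>i\<close> gets
  \<open>x $ i\<close>, and \<open>p\<close> and \<open>q\<close> in addition get the payoff of rock-paper-scissors, where a tie costs both
  of them. An original strategy is an exit option with bonus 0. The two bonuses never have a positive
  sum, and obedience against the exit option makes each of them nonnegative on average. So in a
  correlated equilibrium both bonuses vanish on average, recommendation by recommendation, and the
  support avoids ties and miscoordination. Hence it is a mixture of a correlated equilibrium of \<open>G\<close>
  and of block parts with payoff vectors in \<open>X\<close>; conversely the uniform distribution on the six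
  untied pairs of a block is an equilibrium. In a product distribution, a block strategy \<open>k\<close> of one
  player forces \<open>k + 1\<close> (mod 3) in the support of the other, so after three steps a tie
  has positive probability. Therefore no Nash equilibrium uses the blocks.
\<close>

section \<open>Finite expectations\<close>

abbreviation expect :: "'c pmf \<Rightarrow> ('c \<Rightarrow> real) \<Rightarrow> real" where
  "expect \<equiv> measure_pmf.expectation"

lemma expect_finite_support:
  assumes "finite A" "set_pmf \<mu> \<subseteq> A"
  shows "expect \<mu> f = (\<Sum>s\<in>A. pmf \<mu> s * f s)"
  using assms by (subst integral_measure_pmf[of A]) auto

lemma expect_cong:
  assumes "\<And>s. s \<in> set_pmf \<mu> \<Longrightarrow> f s = g s"
  shows "expect \<mu> f = expect \<mu> g"
  using assms by (intro integral_cong_AE) (auto simp: AE_measure_pmf_iff)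

lemma expect_mono:
  assumes "finite (set_pmf \<mu>)" "\<And>s. s \<in> set_pmf \<mu> \<Longrightarrow> f s \<le> g s"
  shows "expect \<mu> f \<le> expect \<mu> g"
  using assms by (intro integral_mono_AE) (auto simp: AE_measure_pmf_iff integrable_measure_pmf_finite)

lemma expect_add:
  assumes "finite (set_pmf \<mu>)"
  shows "expect \<mu> (\<lambda>s. f s + g s) = expect \<mu> f + expect \<mu> g"
  using assms by (intro Bochner_Integration.integral_add) (auto simp: integrable_measure_pmf_finite)

lemma expect_diff:
  assumes "finite (set_pmf \<mu>)"
  shows "expect \<mu> (\<lambda>s. f s - g s) = expect \<mu> f - expect \<mu> g"
  using assms by (intro Bochner_Integration.integral_diff) (auto simp: integrable_measure_pmf_finite)

lemma expect_sum:
  assumes "finite (set_pmf \<mu>)"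
  shows "expect \<mu> (\<lambda>s. \<Sum>c\<in>C. f c s) = (\<Sum>c\<in>C. expect \<mu> (f c))"
  using assms by (intro Bochner_Integration.integral_sum) (auto simp: integrable_measure_pmf_finite)

lemma expect_zero_nonpos:
  assumes fin: "finite (set_pmf \<mu>)" and "expect \<mu> f = 0"
    and "\<And>s. s \<in> set_pmf \<mu> \<Longrightarrow> f s \<le> 0" and "s \<in> set_pmf \<mu>"
  shows "f s = 0"
proof -
  have "(\<Sum>s\<in>set_pmf \<mu>. - (pmf \<mu> s * f s)) = 0"
    using assms(2) expect_finite_support[OF fin order_refl, of f] by (simp add: sum_negf)
  then have "- (pmf \<mu> s * f s) = 0"
    using assms by (subst (asm) sum_nonneg_eq_0_iff) (auto simp: mult_nonneg_nonpos)
  then show ?thesis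
    using assms(4) by (simp add: set_pmf_iff)
qed

text \<open>Kept free of division: multiplying by the probability of \<open>A\<close> lets weights
  and conditional expectations recombine directly when an equilibrium is split into parts.\<close>

lemma expect_cond_pmf:
  assumes fin: "finite (set_pmf \<mu>)" and ne: "set_pmf \<mu> \<inter> A \<noteq> {}"
  shows "measure_pmf.prob \<mu> A * expect (cond_pmf \<mu> A) f = expect \<mu> (\<lambda>s. of_bool (s \<in> A) * f s)"
proof -
  have "measure_pmf.prob \<mu> A \<noteq> 0"
    using ne measure_pmf_posI[of _ \<mu> A] by fastforce
  moreover have "expect (cond_pmf \<mu> A) f = (\<Sum>s\<in>set_pmf \<mu>. pmf (cond_pmf \<mu> A) s * f s)"
    using fin ne by (intro expect_finite_support) auto
  ultimately show ?thesis
    using expect_finite_support[OF fin order_refl, of "\<lambda>s. of_bool (s \<in> A) * f s"] ne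
    by (simp add: pmf_cond sum_distrib_left) (intro sum.cong; simp)
qed

lemma expect_bind_pmf:
  assumes "finite (set_pmf \<tau>)" "\<And>y. finite (set_pmf (M y))"
  shows "expect (bind_pmf \<tau> M) f = expect \<tau> (\<lambda>y. expect (M y) f)"
  using assms pmf_expectation_bind[of "set_pmf \<tau>" M \<tau> f]
    expect_finite_support[of "set_pmf \<tau>" \<tau> "\<lambda>y. expect (M y) f"] by simp

section \<open>Correlated equilibria and Nash equilibria\<close>

text \<open>The indicator of the recommendation replaces the sum over opponent profiles, so each
  incentive constraint is one expectation, linear in the distribution.\<close>

definition gain :: "('n::finite, 'a) game \<Rightarrow> 'n \<Rightarrow> 'a \<Rightarrow> 'a \<Rightarrow> ('n \<Rightarrow> 'a) \<Rightarrow> real" where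
  "gain G i a b s = of_bool (s i = a) * (payoff G i s - payoff G i (s(i := b)))"

lemma finite_profiles: "finite_game G \<Longrightarrow> finite (profiles G)"
  unfolding finite_game_def profiles_def by (intro finite_PiE) auto

lemma finite_set_pmf_profiles: "finite_game G \<Longrightarrow> set_pmf \<mu> \<subseteq> profiles G \<Longrightarrow> finite (set_pmf \<mu>)"
  using finite_profiles finite_subset by blast

lemma mem_profiles: "s \<in> profiles G \<longleftrightarrow> (\<forall>i. s i \<in> strats G i)"
  unfolding profiles_def by (auto simp: PiE_def)

lemma exp_payoff_eq:
  assumes "finite_game G" "set_pmf \<mu> \<subseteq> profiles G"
  shows "exp_payoff G i \<mu> = expect \<mu> (payoff G i)"
  unfolding exp_payoff_def using expect_finite_support[OF finite_profiles] assms by metis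

lemma sum_opp_profiles:
  assumes "finite_game G" "a \<in> strats G i"
  shows "(\<Sum>r\<in>opp_profiles G i. f (r(i := a))) = (\<Sum>s\<in>profiles G. of_bool (s i = a) * (f s :: real))"
proof -
  have "(\<Sum>s\<in>profiles G. of_bool (s i = a) * f s) = (\<Sum>s\<in>{s\<in>profiles G. s i = a}. f s)"
    unfolding sum.inter_filter[OF finite_profiles[OF assms(1)]] by (intro sum.cong) auto
  also have "\<dots> = (\<Sum>r\<in>opp_profiles G i. f (r(i := a)))"
  \<comment> \<open>Opponent profiles carry \<open>undefined\<close> at \<open>i\<close>, hence this
    inverse of inserting \<open>a\<close>.\<close>
  proof (rule sum.reindex_bij_witness[where i = "\<lambda>r. r(i := a)" and j = "\<lambda>s. s(i := undefined)"])
  qed (use assms(2) in \<open>auto simp: mem_profiles opp_profiles_def PiE_def extensional_def\<close>)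
  finally show ?thesis by simp
qed

lemma correlated_eq_iff:
  assumes "finite_game G"
  shows "correlated_eq G \<mu> \<longleftrightarrow> set_pmf \<mu> \<subseteq> profiles G \<and>
    (\<forall>i. \<forall>a\<in>strats G i. \<forall>b\<in>strats G i. 0 \<le> expect \<mu> (gain G i a b))"
proof (cases "set_pmf \<mu> \<subseteq> profiles G")
  case True
  have "(\<Sum>r\<in>opp_profiles G i.
           pmf \<mu> (r(i := a)) * (payoff G i (r(i := a)) - payoff G i (r(i := b))))
      = expect \<mu> (gain G i a b)" if "a \<in> strats G i" for i a b
    using sum_opp_profiles[OF assms that, of "\<lambda>s. pmf \<mu> s * (payoff G i s - payoff G i (s(i := b)))"]
      expect_finite_support[OF finite_profiles[OF assms] True, of "gain G i a b"]
    by (simp add: gain_def mult_ac)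
  then show ?thesis
    using True unfolding correlated_eq_def by auto
qed (auto simp: correlated_eq_def)

lemma set_induced_dist: "set_pmf (induced_dist \<sigma>) = {s. \<forall>i. s i \<in> set_pmf (\<sigma> i)}"
  unfolding induced_dist_def by (auto simp: set_Pi_pmf PiE_dflt_def)

lemma set_induced_dist_profiles: "set_pmf (induced_dist \<sigma>) \<subseteq> profiles G \<longleftrightarrow> mixed_profile G \<sigma>"
proof
  assume l: "set_pmf (induced_dist \<sigma>) \<subseteq> profiles G"
  show "mixed_profile G \<sigma>"
    unfolding mixed_profile_def
  proof (intro allI subsetI)
    fix i a assume a: "a \<in> set_pmf (\<sigma> i)"
    have "\<forall>j. \<exists>b. b \<in> set_pmf (\<sigma> j)"
      using set_pmf_not_empty by (metis ex_in_conv)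
    then obtain s where "\<And>j. s j \<in> set_pmf (\<sigma> j)"
      by metis
    then have "s(i := a) \<in> profiles G"
      using a l by (auto simp: set_induced_dist)
    then show "a \<in> strats G i"
      unfolding mem_profiles by (metis fun_upd_same)
  qed
next
  assume "mixed_profile G \<sigma>"
  then show "set_pmf (induced_dist \<sigma>) \<subseteq> profiles G"
    by (force simp: set_induced_dist mixed_profile_def mem_profiles)
qed

text \<open>By independence, a deviation to \<open>\<tau>\<close> amounts to drawing a profile from
  \<open>\<sigma>\<close> and overwriting coordinate \<open>i\<close> by a separate draw from
  \<open>\<tau>\<close>.\<close>

lemma induced_dist_upd:
  "induced_dist (\<sigma>(i := \<tau>)) = bind_pmf \<tau> (\<lambda>y. map_pmf (\<lambda>s. s(i := y)) (induced_dist \<sigma>))"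
proof -
  let ?R = "Pi_pmf (UNIV - {i}) undefined \<sigma>"
  have ins: "induced_dist \<rho> = bind_pmf (\<rho> i) (\<lambda>y. bind_pmf ?R (\<lambda>f. return_pmf (f(i := y))))"
    if "\<And>j. j \<noteq> i \<Longrightarrow> \<rho> j = \<sigma> j" for \<rho>
  proof -
    have "Pi_pmf (UNIV - {i}) undefined \<rho> = ?R"
      using that by (intro Pi_pmf_cong) auto
    then show ?thesis
      using Pi_pmf_insert'[of "UNIV - {i}" i undefined \<rho>]
      by (simp add: induced_dist_def insert_absorb)
  qed
  show ?thesis
    by (subst ins, simp, subst ins)
       (simp_all add: map_bind_pmf bind_return_pmf map_pmf_def[symmetric] pmf.map_comp o_def)
qed

lemma finite_set_mixed: "finite_game G \<Longrightarrow> mixed_profile G \<sigma> \<Longrightarrow> finite (set_pmf (\<sigma> i))"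
  unfolding finite_game_def mixed_profile_def using finite_subset by metis

lemma expect_induced_dist_upd:
  assumes "finite_game G" "mixed_profile G \<sigma>" "finite (set_pmf \<tau>)"
  shows "expect (induced_dist (\<sigma>(i := \<tau>))) f
    = expect \<tau> (\<lambda>y. expect (induced_dist \<sigma>) (\<lambda>s. f (s(i := y))))"
proof -
  have "finite (set_pmf (induced_dist \<sigma>))"
    using assms finite_set_pmf_profiles set_induced_dist_profiles by metis
  then show ?thesis
    unfolding induced_dist_upd using assms by (subst expect_bind_pmf) auto
qed

text \<open>The product structure decouples the recommendation to player \<open>i\<close> from the play of the
  opponents, so obeying it is optimal iff the mixed strategy is a best reply.\<close>

lemma nash_eq_iff_correlated_eq:
  assumes G: "finite_game G"
  shows "nash_eq G \<sigma> \<longleftrightarrow> correlated_eq G (induced_dist \<sigma>)"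
proof (cases "mixed_profile G \<sigma>")
  case mixed: True
  define V where "V i b = expect (induced_dist \<sigma>) (\<lambda>s. payoff G i (s(i := b)))" for i b
  have fin: "finite (set_pmf (induced_dist \<sigma>))"
    using G finite_set_pmf_profiles mixed set_induced_dist_profiles by metis
  have fins: "finite (set_pmf (\<sigma> i))" for i
    using finite_set_mixed[OF G mixed] .
  have dev: "exp_payoff G i (induced_dist (\<sigma>(i := \<tau>))) = expect \<tau> (V i)"
    if "set_pmf \<tau> \<subseteq> strats G i" for i \<tau>
  proof -
    have "mixed_profile G (\<sigma>(i := \<tau>))"
      using mixed that by (auto simp: mixed_profile_def)
    moreover have "finite (set_pmf \<tau>)"
      using G that finite_subset by (auto simp: finite_game_def)
    ultimately show ?thesis
      using G mixed
      by (simp add: exp_payoff_eq set_induced_dist_profiles expect_induced_dist_upd V_def[abs_def])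
  qed
  have own: "exp_payoff G i (induced_dist \<sigma>) = expect (\<sigma> i) (V i)" for i
    using dev[of "\<sigma> i" i] mixed by (simp add: mixed_profile_def)
  have gain: "expect (induced_dist \<sigma>) (gain G i a b) = pmf (\<sigma> i) a * (V i a - V i b)" for i a b
  proof -
    have "expect (induced_dist \<sigma>) (gain G i a b)
        = expect (\<sigma> i) (\<lambda>y. expect (induced_dist \<sigma>) (\<lambda>s. gain G i a b (s(i := y))))"
      \<comment> \<open>The deviation to \<open>\<sigma> i\<close> itself changes nothing; it merely
        resamples coordinate \<open>i\<close>, which separates it from the opponents.\<close>
      using expect_induced_dist_upd[OF G mixed fins[of i], where i=i and f="gain G i a b"] by simp
    also have "\<dots> = expect (\<sigma> i) (\<lambda>y. of_bool (y = a) * (V i a - V i b))"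
      by (intro expect_cong) (auto simp: gain_def V_def expect_diff[OF fin])
    also have "\<dots> = pmf (\<sigma> i) a * (V i a - V i b)"
      by (subst integral_measure_pmf[of "{a}"]) auto
    finally show ?thesis .
  qed
  have "(\<forall>\<tau>. set_pmf \<tau> \<subseteq> strats G i \<longrightarrow> expect \<tau> (V i) \<le> expect (\<sigma> i) (V i)) \<longleftrightarrow>
      (\<forall>a\<in>strats G i. \<forall>b\<in>strats G i. 0 \<le> pmf (\<sigma> i) a * (V i a - V i b))" (is "?L \<longleftrightarrow> ?R") for i
  proof
    assume L: ?L
    show ?R
    proof (intro ballI)
      fix a b assume ab: "a \<in> strats G i" "b \<in> strats G i"
      \<comment> \<open>This deviation shifts the mass of \<open>a\<close> to \<open>b\<close>, so
        what it loses is exactly the incentive term for \<open>a\<close> and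
        \<open>b\<close>.\<close>
      define \<tau> where "\<tau> = map_pmf (\<lambda>y. if y = a then b else y) (\<sigma> i)"
      have "set_pmf \<tau> \<subseteq> strats G i"
        using ab mixed by (auto simp: \<tau>_def mixed_profile_def)
      then have "expect \<tau> (V i) \<le> expect (\<sigma> i) (V i)"
        using L by blast
      moreover have "expect \<tau> (V i) = expect (\<sigma> i) (\<lambda>y. V i y - of_bool (y = a) * (V i a - V i b))"
        unfolding \<tau>_def by (auto intro!: expect_cong)
      moreover have "expect (\<sigma> i) (\<lambda>y. of_bool (y = a) * (V i a - V i b)) = pmf (\<sigma> i) a * (V i a - V i b)"
        by (subst integral_measure_pmf[of "{a}"]) auto
      ultimately show "0 \<le> pmf (\<sigma> i) a * (V i a - V i b)"
        unfolding expect_diff[OF fins] by linarith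
    qed
  next
    assume R: ?R
    have best: "V i b \<le> expect (\<sigma> i) (V i)" if "b \<in> strats G i" for b
    proof -
      have "expect (\<sigma> i) (\<lambda>_. V i b) \<le> expect (\<sigma> i) (V i)"
      proof (rule expect_mono[OF fins])
        fix a assume a: "a \<in> set_pmf (\<sigma> i)"
        \<comment> \<open>On the support the factor is positive and can be cancelled: each strategy
          in use is at least as good as \<open>b\<close>, and so is their average.\<close>
        then have "0 \<le> pmf (\<sigma> i) a * (V i a - V i b)" "pmf (\<sigma> i) a > 0"
          using R that mixed by (auto simp: mixed_profile_def pmf_positive)
        then show "V i b \<le> V i a"
          by (simp add: zero_le_mult_iff)
      qed
      then show ?thesis by simp
    qed
    show ?L
    proof (intro allI impI)
      fix \<tau> assume \<tau>: "set_pmf \<tau> \<subseteq> strats G i"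
      then have "finite (set_pmf \<tau>)"
        using G finite_subset by (auto simp: finite_game_def)
      then have "expect \<tau> (V i) \<le> expect \<tau> (\<lambda>_. expect (\<sigma> i) (V i))"
        using best \<tau> by (intro expect_mono) auto
      then show "expect \<tau> (V i) \<le> expect (\<sigma> i) (V i)"
        by simp
    qed
  qed
  then show ?thesis
    unfolding nash_eq_def correlated_eq_iff[OF G]
    using mixed by (simp add: own dev gain set_induced_dist_profiles)
qed (auto simp: nash_eq_def correlated_eq_def set_induced_dist_profiles)

lemma NEP_eq:
  "finite_game G \<Longrightarrow> NEP G = {payoff_vec G (induced_dist \<sigma>) | \<sigma>. correlated_eq G (induced_dist \<sigma>)}"
  unfolding NEP_def by (simp add: nash_eq_iff_correlated_eq)

text \<open>Incentive constraints and payoffs are linear in the distribution, so a coin with bias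
  \<open>u\<close> choosing between two equilibria realizes the convex combination.\<close>

lemma convex_CEP:
  assumes G: "finite_game G"
  shows "convex (CEP G)"
proof (rule convexI)
  fix x y and u v :: real
  assume "x \<in> CEP G" "y \<in> CEP G" and uv: "0 \<le> u" "0 \<le> v" "u + v = 1"
  then obtain \<mu> \<nu> where \<mu>: "correlated_eq G \<mu>" "x = payoff_vec G \<mu>"
    and \<nu>: "correlated_eq G \<nu>" "y = payoff_vec G \<nu>"
    by (auto simp: CEP_def)
  define \<rho> where "\<rho> = bind_pmf (bernoulli_pmf u) (\<lambda>b. if b then \<mu> else \<nu>)"
  have sub: "set_pmf \<mu> \<subseteq> profiles G" "set_pmf \<nu> \<subseteq> profiles G"
    using \<mu> \<nu> by (auto simp: correlated_eq_def)
  then have sub\<rho>: "set_pmf \<rho> \<subseteq> profiles G"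
    by (auto simp: \<rho>_def split: if_splits)
  have "expect \<rho> f = u * expect \<mu> f + v * expect \<nu> f" for f
  proof -
    have "expect \<rho> f = expect (bernoulli_pmf u) (\<lambda>b. expect (if b then \<mu> else \<nu>) f)"
      unfolding \<rho>_def using sub finite_set_pmf_profiles[OF G] by (intro expect_bind_pmf) auto
    also have "\<dots> = u * expect \<mu> f + v * expect \<nu> f"
      using uv by (subst integral_bernoulli_pmf) (auto simp: eq_diff_eq[symmetric])
    finally show ?thesis .
  qed
  then have "correlated_eq G \<rho>" "payoff_vec G \<rho> = u *\<^sub>R x + v *\<^sub>R y"
    using \<mu> \<nu> uv sub sub\<rho>
    by (auto simp: correlated_eq_iff[OF G] payoff_vec_def exp_payoff_eq[OF G] vec_eq_iff)
  then show "u *\<^sub>R x + v *\<^sub>R y \<in> CEP G"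
    unfolding CEP_def by force
qed

section \<open>Embedding a game into one with dominated extra strategies\<close>

text \<open>In \<open>dominated\<close> the substitute \<open>d'\<close> must serve against all
  embedded profiles at once; then a constraint against \<open>d\<close> follows from a single
  constraint of \<open>G\<close> against \<open>d'\<close>.\<close>

locale game_embedding =
  fixes G :: "('n::finite, 'a) game" and H :: "('n, 'b) game" and f :: "'a \<Rightarrow> 'b"
  assumes finG: "finite_game G" and finH: "finite_game H"
    and inj: "inj_on f (strats G i)"
    and strats: "a \<in> strats G i \<Longrightarrow> f a \<in> strats H i"
    and payoff: "s \<in> profiles G \<Longrightarrow> payoff H i (f \<circ> s) = payoff G i s"
    and dominated: "d \<in> strats H i \<Longrightarrow>
      \<exists>d'\<in>strats G i. \<forall>s\<in>profiles G. payoff H i ((f \<circ> s)(i := d)) \<le> payoff G i (s(i := d'))"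
begin

lemma map_profiles: "set_pmf \<mu> \<subseteq> profiles G \<Longrightarrow> set_pmf (map_pmf ((\<circ>) f) \<mu>) \<subseteq> profiles H"
  using strats by (auto simp: mem_profiles)

lemma payoff_vec_map:
  assumes "set_pmf \<mu> \<subseteq> profiles G"
  shows "payoff_vec H (map_pmf ((\<circ>) f) \<mu>) = payoff_vec G \<mu>"
proof -
  have "expect (map_pmf ((\<circ>) f) \<mu>) (payoff H i) = expect \<mu> (payoff G i)" for i
    using assms payoff by (auto intro!: expect_cong)
  then show ?thesis
    unfolding payoff_vec_def exp_payoff_eq[OF finG assms] exp_payoff_eq[OF finH map_profiles[OF assms]]
    by simp
qed

lemma correlated_eq_map_iff:
  assumes sub: "set_pmf \<mu> \<subseteq> profiles G"
  shows "correlated_eq H (map_pmf ((\<circ>) f) \<mu>) \<longleftrightarrow> correlated_eq G \<mu>"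
proof
  have fin: "finite (set_pmf \<mu>)"
    using finG sub finite_set_pmf_profiles by metis
  {
    assume H: "correlated_eq H (map_pmf ((\<circ>) f) \<mu>)"
    have "0 \<le> expect \<mu> (gain G i a b)" if ab: "a \<in> strats G i" "b \<in> strats G i" for i a b
    proof -
      have "0 \<le> expect (map_pmf ((\<circ>) f) \<mu>) (gain H i (f a) (f b))"
        using H ab strats unfolding correlated_eq_iff[OF finH] by blast
      also have "\<dots> = expect \<mu> (gain G i a b)"
        unfolding integral_map_pmf
      proof (rule expect_cong)
        fix s assume "s \<in> set_pmf \<mu>"
        then have s: "s \<in> profiles G" using sub by auto
        then have "s(i := b) \<in> profiles G" using ab by (auto simp: mem_profiles)
        then have "payoff H i ((f \<circ> s)(i := f b)) = payoff G i (s(i := b))"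
          using payoff by (metis fun_upd_comp)
        moreover have "f (s i) = f a \<longleftrightarrow> s i = a"
          using inj_on_eq_iff[OF inj] s ab by (auto simp: mem_profiles)
        ultimately show "gain H i (f a) (f b) (f \<circ> s) = gain G i a b s"
          using payoff[OF s] by (simp add: gain_def)
      qed
      finally show ?thesis .
    qed
    then show "correlated_eq G \<mu>"
      using sub by (simp add: correlated_eq_iff[OF finG])
  }
  {
    assume G: "correlated_eq G \<mu>"
    have "0 \<le> expect \<mu> (\<lambda>s. gain H i c d (f \<circ> s))" if cd: "c \<in> strats H i" "d \<in> strats H i" for i c d
    proof (cases "c \<in> f ` strats G i")
      \<comment> \<open>An embedded recommendation inherits its constraint from \<open>d'\<close>;
        any other is never made, and its gain vanishes.\<close>
      case True
      then obtain a where a: "a \<in> strats G i" "c = f a" by auto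
      obtain d' where d': "d' \<in> strats G i"
        "\<And>s. s \<in> profiles G \<Longrightarrow> payoff H i ((f \<circ> s)(i := d)) \<le> payoff G i (s(i := d'))"
        using dominated[OF cd(2)] by blast
      have "0 \<le> expect \<mu> (gain G i a d')"
        using G a d' unfolding correlated_eq_iff[OF finG] by blast
      also have "\<dots> \<le> expect \<mu> (\<lambda>s. gain H i c d (f \<circ> s))"
      proof (rule expect_mono[OF fin])
        fix s assume "s \<in> set_pmf \<mu>"
        then have s: "s \<in> profiles G" using sub by auto
        have "f (s i) = c \<longleftrightarrow> s i = a"
          using inj_on_eq_iff[OF inj] s a by (auto simp: mem_profiles)
        then show "gain G i a d' s \<le> gain H i c d (f \<circ> s)"
          using payoff[OF s] d'(2)[OF s] by (simp add: gain_def)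
      qed
      finally show ?thesis .
    next
      case False
      then have "expect \<mu> (\<lambda>s. gain H i c d (f \<circ> s)) = expect \<mu> (\<lambda>_. 0)"
        using sub by (intro expect_cong) (auto simp: gain_def mem_profiles)
      then show ?thesis by simp
    qed
    then show "correlated_eq H (map_pmf ((\<circ>) f) \<mu>)"
      using map_profiles[OF sub] by (simp add: correlated_eq_iff[OF finH])
  }
qed

lemma induced_dist_map: "induced_dist (\<lambda>i. map_pmf f (\<sigma> i)) = map_pmf ((\<circ>) f) (induced_dist \<sigma>)"
proof -
  \<comment> \<open>The default value may be changed freely because the index set is
    \<open>UNIV\<close>; \<open>Pi_pmf_map\<close> asks for the image of the old default.\<close>
  have "induced_dist (\<lambda>i. map_pmf f (\<sigma> i)) = Pi_pmf UNIV (f undefined) (\<lambda>i. map_pmf f (\<sigma> i))"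
    unfolding induced_dist_def by (intro pmf_eqI) (simp add: pmf_Pi)
  then show ?thesis
    unfolding induced_dist_def by (simp add: Pi_pmf_map)
qed

lemma CEP_preimage:
  assumes "correlated_eq H \<nu>" "set_pmf \<nu> \<subseteq> {s. \<forall>i. s i \<in> f ` strats G i}"
  shows "payoff_vec H \<nu> \<in> CEP G"
proof -
  define g where "g s i = inv_into (strats G i) f (s i)" for s i
  have s: "f \<circ> g s = s" "g s \<in> profiles G" if "s \<in> set_pmf \<nu>" for s
  proof -
    have "\<forall>i. s i \<in> f ` strats G i" using assms that by auto
    then show "f \<circ> g s = s" "g s \<in> profiles G"
      by (auto simp: g_def fun_eq_iff f_inv_into_f inv_into_into mem_profiles)
  qed
  have "map_pmf ((\<circ>) f) (map_pmf g \<nu>) = \<nu>"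
    using s by (auto simp: pmf.map_comp o_def[of "(\<circ>) f"] intro!: map_pmf_idI)
  moreover have "set_pmf (map_pmf g \<nu>) \<subseteq> profiles G"
    using s by auto
  ultimately show ?thesis
    using assms payoff_vec_map correlated_eq_map_iff unfolding CEP_def by (metis (mono_tags, lifting) mem_Collect_eq)
qed

lemma CEP_subset: "CEP G \<subseteq> CEP H"
proof
  fix x assume "x \<in> CEP G"
  then obtain \<mu> where \<mu>: "correlated_eq G \<mu>" "x = payoff_vec G \<mu>"
    by (auto simp: CEP_def)
  then have "set_pmf \<mu> \<subseteq> profiles G"
    by (simp add: correlated_eq_def)
  then have "correlated_eq H (map_pmf ((\<circ>) f) \<mu>)" "x = payoff_vec H (map_pmf ((\<circ>) f) \<mu>)"
    using \<mu> by (simp_all add: payoff_vec_map correlated_eq_map_iff)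
  then show "x \<in> CEP H"
    unfolding CEP_def by blast
qed

text \<open>Nash equilibria are the product correlated equilibria, and both directions of the
  embedding preserve products. What remains to check is that no equilibrium of \<open>H\<close>
  mixes in an added strategy.\<close>

lemma NEP_eqI:
  assumes "\<And>\<sigma> i. correlated_eq H (induced_dist \<sigma>) \<Longrightarrow> set_pmf (\<sigma> i) \<subseteq> f ` strats G i"
  shows "NEP H = NEP G"
proof (intro equalityI subsetI)
  fix x assume "x \<in> NEP G"
  then obtain \<sigma> where \<sigma>: "correlated_eq G (induced_dist \<sigma>)" "x = payoff_vec G (induced_dist \<sigma>)"
    by (auto simp: NEP_eq[OF finG])
  then have "set_pmf (induced_dist \<sigma>) \<subseteq> profiles G"
    by (simp add: correlated_eq_def)
  then have "correlated_eq H (induced_dist (\<lambda>i. map_pmf f (\<sigma> i)))"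
    "x = payoff_vec H (induced_dist (\<lambda>i. map_pmf f (\<sigma> i)))"
    unfolding induced_dist_map using \<sigma> by (simp_all add: payoff_vec_map correlated_eq_map_iff)
  then show "x \<in> NEP H"
    unfolding NEP_eq[OF finH] by blast
next
  fix x assume "x \<in> NEP H"
  then obtain \<sigma> where \<sigma>: "correlated_eq H (induced_dist \<sigma>)" "x = payoff_vec H (induced_dist \<sigma>)"
    by (auto simp: NEP_eq[OF finH])
  define \<tau> where "\<tau> i = map_pmf (inv_into (strats G i) f) (\<sigma> i)" for i
  have sub: "set_pmf (\<sigma> i) \<subseteq> f ` strats G i" for i
    using assms \<sigma> by blast
  then have "map_pmf f (\<tau> i) = \<sigma> i" for i
    unfolding \<tau>_def pmf.map_comp using f_inv_into_f[of _ f "strats G i"] sub[of i]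
    by (intro map_pmf_idI) auto
  then have eq: "induced_dist \<sigma> = map_pmf ((\<circ>) f) (induced_dist \<tau>)"
    unfolding induced_dist_map[symmetric] by simp
  have "set_pmf (induced_dist \<tau>) \<subseteq> profiles G"
    using sub unfolding set_induced_dist_profiles
    by (auto simp: mixed_profile_def \<tau>_def intro!: inv_into_into)
  then show "x \<in> NEP G"
    using \<sigma> payoff_vec_map correlated_eq_map_iff unfolding NEP_eq[OF finG] eq by blast
qed

end

text \<open>The block construction changes the strategy type, so its result is finally relabelled by
  natural numbers.\<close>

lemma ex_nat_game:
  fixes G :: "('n::finite, 'a) game"
  assumes G: "finite_game G"
  shows "\<exists>H :: ('n, nat) game. finite_game H \<and> NEP H = NEP G \<and> CEP H = CEP G"
proof -
  have "finite (\<Union>i. strats G i)"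
    using G by (simp add: finite_game_def)
  then obtain f :: "'a \<Rightarrow> nat" where f: "inj_on f (\<Union>i. strats G i)"
    using finite_imp_inj_to_nat_seg by metis
  then have inj: "inj_on f (strats G i)" for i
    by (rule inj_on_subset) auto
  define H :: "('n, nat) game" where
    "H = \<lparr>strats = \<lambda>i. f ` strats G i, payoff = \<lambda>i s. payoff G i (\<lambda>j. inv_into (strats G j) f (s j))\<rparr>"
  have pay: "payoff H i (f \<circ> s) = payoff G i s" if "s \<in> profiles G" for i s
    using that inj by (simp add: H_def mem_profiles)
  interpret game_embedding G H f
  proof
    fix d i assume "d \<in> strats H i"
    then obtain d' where d': "d' \<in> strats G i" "d = f d'"
      by (auto simp: H_def)
    have "payoff H i ((f \<circ> s)(i := d)) = payoff G i (s(i := d'))" if "s \<in> profiles G" for s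
    proof -
      have "s(i := d') \<in> profiles G"
        using that d' by (auto simp: mem_profiles)
      then show ?thesis
        using pay d'(2) by (metis fun_upd_comp)
    qed
    then show "\<exists>d'\<in>strats G i. \<forall>s\<in>profiles G. payoff H i ((f \<circ> s)(i := d)) \<le> payoff G i (s(i := d'))"
      using d' by force
  qed (use G inj pay in \<open>auto simp: finite_game_def H_def\<close>)
  have "NEP H = NEP G"
  proof (rule NEP_eqI)
    fix \<sigma> i assume "correlated_eq H (induced_dist \<sigma>)"
    then have "mixed_profile H \<sigma>"
      by (simp add: correlated_eq_def set_induced_dist_profiles)
    then show "set_pmf (\<sigma> i) \<subseteq> f ` strats G i"
      by (simp add: mixed_profile_def H_def)
  qed
  moreover have "CEP H \<subseteq> CEP G"
  proof
    fix x assume "x \<in> CEP H"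
    then obtain \<nu> where \<nu>: "correlated_eq H \<nu>" "x = payoff_vec H \<nu>"
      by (auto simp: CEP_def)
    then have "set_pmf \<nu> \<subseteq> {s. \<forall>i. s i \<in> f ` strats G i}"
      by (auto simp: correlated_eq_def mem_profiles H_def)
    then show "x \<in> CEP G"
      using \<nu> CEP_preimage by simp
  qed
  ultimately show ?thesis
    using finH CEP_subset by blast
qed

section \<open>Adding jointly controlled blocks\<close>

text \<open>Payoff for leaving the original game: rock-paper-scissors inside a block, except that
  a tie (like a miscoordination) costs both players.\<close>

definition bonus :: "'a + 'c \<times> nat \<Rightarrow> 'a + 'c \<times> nat \<Rightarrow> real" where
  "bonus c d = (case c of Inl _ \<Rightarrow> 0 | Inr (x, k) \<Rightarrow>
     (case d of Inl _ \<Rightarrow> -1 | Inr (y, l) \<Rightarrow> if x = y \<and> l = Suc k mod 3 then 1 else -1))"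

lemma bonus_Inl [simp]: "bonus (Inl a) d = 0"
  by (simp add: bonus_def)

lemma bonus_Inr: "bonus (Inr (x, k)) d = (if d = Inr (x, Suc k mod 3) then 1 else -1)"
  by (auto simp: bonus_def split: sum.splits)

lemma bonus_sum_nonpos: "bonus c d + bonus d c \<le> 0"
proof (cases "\<exists>x k y l. c = Inr (x, k) \<and> d = Inr (y, l)")
  case True
  then obtain x k y l where cd: "c = Inr (x, k)" "d = Inr (y, l)"
    by blast
  \<comment> \<open>Both players cannot win: that would give \<open>k = k + 2\<close> modulo
    3.\<close>
  have "\<not> (l = Suc k mod 3 \<and> k = Suc l mod 3)"
    by presburger
  then show ?thesis
    by (auto simp: cd bonus_Inr)
qed (cases c; cases d; auto simp: bonus_Inr)

lemma bonus_sum_zero_cases: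
  assumes "bonus c d + bonus d c = 0"
  obtains a b where "c = Inl a" "d = Inl b"
  | x k l where "c = Inr (x, k)" "d = Inr (x, l)"
  using assms by (cases c; cases d) (auto simp: bonus_Inr split: if_splits)

lemma bonus_same: "bonus (Inr z) (Inr z) = -1"
proof -
  have "k \<noteq> Suc k mod 3" for k
    by presburger
  then show ?thesis
    by (cases z) (simp add: bonus_Inr)
qed

text \<open>For each \<open>x \<in> X\<close> the players \<open>p\<close> and \<open>q\<close> get a block of three strategies \<open>(x, k)\<close>. A block
  strategy played outside of its block acts like the fallback strategy \<open>e\<close>, at a cost.\<close>

locale block_extension =
  fixes G :: "('n::finite, 'a) game" and p q :: 'n and e :: "'n \<Rightarrow> 'a" and X :: "(real ^ 'n) set"
  assumes fin: "finite_game G" and pq: "p \<noteq> q" and e: "e i \<in> strats G i" and finX: "finite X"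
begin

text \<open>Players outside \<open>{p, q}\<close> get \<open>p\<close> as opponent: they read the
  block off \<open>p\<close>, and their own bonus is 0 since they only have \<open>Inl\<close>
  strategies.\<close>

definition opp :: "'n \<Rightarrow> 'n" where
  "opp i = (if i = p then q else p)"

definition proj :: "('n \<Rightarrow> 'a + (real ^ 'n) \<times> nat) \<Rightarrow> 'n \<Rightarrow> 'a" where
  "proj s j = (case s j of Inl a \<Rightarrow> a | Inr _ \<Rightarrow> e j)"

text \<open>The case distinction looks at the opponent only. Hence player \<open>i\<close> cannot
  alter \<open>x $ i\<close> by deviating, and swapping an own block strategy for \<open>e i\<close>
  leaves this part of the payoff unchanged.\<close>

definition base :: "'n \<Rightarrow> ('n \<Rightarrow> 'a + (real ^ 'n) \<times> nat) \<Rightarrow> real" where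
  "base i s = (case s (opp i) of Inl _ \<Rightarrow> payoff G i (proj s) | Inr (x, _) \<Rightarrow> x $ i)"

definition own_bonus :: "'n \<Rightarrow> ('n \<Rightarrow> 'a + (real ^ 'n) \<times> nat) \<Rightarrow> real" where
  "own_bonus i s = bonus (s i) (s (opp i))"

definition H :: "('n, 'a + (real ^ 'n) \<times> nat) game" where
  "H = \<lparr>strats = \<lambda>i. Inl ` strats G i \<union> (if i \<in> {p, q} then Inr ` (X \<times> {..<3}) else {}),
        payoff = \<lambda>i s. base i s + own_bonus i s\<rparr>"

lemma opp_neq: "opp i \<noteq> i"
  using pq by (auto simp: opp_def)

lemma opp_opp: "i \<in> {p, q} \<Longrightarrow> opp (opp i) = i"
  using pq by (auto simp: opp_def)

lemma opp_mem: "opp i \<in> {p, q}"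
  by (auto simp: opp_def)

lemma strats_H: "strats H i = Inl ` strats G i \<union> (if i \<in> {p, q} then Inr ` (X \<times> {..<3}) else {})"
  by (simp add: H_def)

lemma payoff_H: "payoff H i s = base i s + own_bonus i s"
  by (simp add: H_def)

lemma finite_game_H: "finite_game H"
  using fin finX by (auto simp: finite_game_def strats_H)

lemma proj_Inl: "proj (Inl \<circ> s) = s"
  by (simp add: proj_def fun_eq_iff)

sublocale game_embedding G H Inl
proof
  fix s i assume "s \<in> profiles G"
  show "payoff H i (Inl \<circ> s) = payoff G i s"
    by (simp add: payoff_H base_def proj_Inl own_bonus_def)
next
  fix d i assume d: "d \<in> strats H i"
  show "\<exists>d'\<in>strats G i. \<forall>s\<in>profiles G. payoff H i ((Inl \<circ> s)(i := d)) \<le> payoff G i (s(i := d'))"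
  proof (cases d)
    case (Inl a)
    then have "proj ((Inl \<circ> s)(i := d)) = s(i := a)" for s
      by (auto simp: proj_def fun_eq_iff)
    then have "payoff H i ((Inl \<circ> s)(i := d)) = payoff G i (s(i := a))" for s
      using Inl opp_neq[of i] by (simp add: payoff_H base_def own_bonus_def)
    then show ?thesis
      using d Inl by (auto simp: strats_H split: if_splits)
  next
    case (Inr z)
    then have "proj ((Inl \<circ> s)(i := d)) = s(i := e i)" for s
      by (auto simp: proj_def fun_eq_iff)
    then have "payoff H i ((Inl \<circ> s)(i := d)) \<le> payoff G i (s(i := e i))" for s
      using Inr opp_neq[of i] by (cases z) (simp add: payoff_H base_def own_bonus_def bonus_Inr)
    then show ?thesis
      using e by blast
  qed
qed (auto simp: fin finite_game_H strats_H)

section \<open>The support of a correlated equilibrium of \<open>H\<close>\<close>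

context
  fixes \<mu>
  assumes CE: "correlated_eq H \<mu>"
begin

lemma supp: "s \<in> set_pmf \<mu> \<Longrightarrow> s i \<in> strats H i"
  using CE by (auto simp: correlated_eq_def mem_profiles)

lemma finite_supp: "finite (set_pmf \<mu>)"
  using CE finite_set_pmf_profiles[OF finite_game_H] by (simp add: correlated_eq_def)

text \<open>Falling back to \<open>e\<close> forfeits exactly the bonus.\<close>

lemma expect_bonus_nonneg:
  assumes c: "c \<in> strats H i"
  shows "0 \<le> expect \<mu> (\<lambda>s. of_bool (s i = c) * own_bonus i s)"
proof (cases c)
  case (Inl a)
  then have "expect \<mu> (\<lambda>s. of_bool (s i = c) * own_bonus i s) = expect \<mu> (\<lambda>_. 0)"
    by (intro expect_cong) (simp add: own_bonus_def)
  then show ?thesis by simp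
next
  case (Inr z)
  have "Inl (e i) \<in> strats H i"
    using e by (simp add: strats_H)
  then have "0 \<le> expect \<mu> (gain H i c (Inl (e i)))"
    using CE c unfolding correlated_eq_iff[OF finite_game_H] by blast
  also have "\<dots> = expect \<mu> (\<lambda>s. of_bool (s i = c) * own_bonus i s)"
  proof (rule expect_cong)
    fix s
    have "proj (s(i := Inl (e i))) = proj s" if "s i = c"
      using that Inr by (auto simp: proj_def fun_eq_iff)
    then show "gain H i c (Inl (e i)) s = of_bool (s i = c) * own_bonus i s"
      using opp_neq[of i] by (auto simp: gain_def payoff_H base_def own_bonus_def split: sum.splits)
  qed
  finally show ?thesis .
qed

lemma expect_bonus_sum:
  "expect \<mu> (own_bonus i) = (\<Sum>c\<in>strats H i. expect \<mu> (\<lambda>s. of_bool (s i = c) * own_bonus i s))"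
proof -
  have "finite (strats H i)"
    using finite_game_H by (simp add: finite_game_def)
  then have "expect \<mu> (own_bonus i) = expect \<mu> (\<lambda>s. \<Sum>c\<in>strats H i. of_bool (s i = c) * own_bonus i s)"
    using supp by (intro expect_cong) (simp add: of_bool_def if_distrib[of "\<lambda>x. x * _"] cong: if_cong)
  then show ?thesis
    by (simp add: expect_sum[OF finite_supp])
qed

text \<open>Each bonus has nonnegative mean by obedience, while the two never add up to more than 0;
  so all inequalities are equalities.\<close>

lemma expect_bonus_total:
  "expect \<mu> (\<lambda>s. own_bonus p s + own_bonus q s) = 0"
  "expect \<mu> (own_bonus p) = 0" "expect \<mu> (own_bonus q) = 0"
proof -
  have "0 \<le> expect \<mu> (own_bonus i)" for i
    unfolding expect_bonus_sum by (intro sum_nonneg expect_bonus_nonneg)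
  from this[of p] this[of q]
  have "0 \<le> expect \<mu> (own_bonus p)" "0 \<le> expect \<mu> (own_bonus q)" .
  moreover have "expect \<mu> (\<lambda>s. own_bonus p s + own_bonus q s) \<le> expect \<mu> (\<lambda>_. 0)"
    using bonus_sum_nonpos pq by (intro expect_mono[OF finite_supp]) (simp add: own_bonus_def opp_def)
  ultimately show "expect \<mu> (\<lambda>s. own_bonus p s + own_bonus q s) = 0"
    "expect \<mu> (own_bonus p) = 0" "expect \<mu> (own_bonus q) = 0"
    unfolding expect_add[OF finite_supp]
    by auto
qed

lemma expect_bonus_zero:
  assumes "i \<in> {p, q}" "c \<in> strats H i"
  shows "expect \<mu> (\<lambda>s. of_bool (s i = c) * own_bonus i s) = 0"
proof -
  have "finite (strats H i)"
    using finite_game_H by (simp add: finite_game_def)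
  moreover have "(\<Sum>c\<in>strats H i. expect \<mu> (\<lambda>s. of_bool (s i = c) * own_bonus i s)) = 0"
    using assms expect_bonus_total unfolding expect_bonus_sum[symmetric] by auto
  ultimately have "\<forall>c\<in>strats H i. expect \<mu> (\<lambda>s. of_bool (s i = c) * own_bonus i s) = 0"
    by (subst (asm) sum_nonneg_eq_0_iff) (auto intro: expect_bonus_nonneg)
  then show ?thesis
    using assms(2) by blast
qed

lemma bonus_sum_zero:
  assumes "s \<in> set_pmf \<mu>"
  shows "bonus (s p) (s q) + bonus (s q) (s p) = 0"
proof -
  have "own_bonus p s + own_bonus q s = 0"
    using bonus_sum_nonpos pq assms
    by (intro expect_zero_nonpos[OF finite_supp expect_bonus_total(1)]) (auto simp: own_bonus_def opp_def)
  then show ?thesis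
    using pq by (simp add: own_bonus_def opp_def)
qed

lemma supp_cases:
  assumes "s \<in> set_pmf \<mu>"
  obtains "\<And>i. s i \<in> Inl ` strats G i"
  | x k l where "x \<in> X" "k < 3" "l < 3" "s p = Inr (x, k)" "s q = Inr (x, l)"
      "\<And>i. i \<notin> {p, q} \<Longrightarrow> s i \<in> Inl ` strats G i"
  using bonus_sum_zero[OF assms]
proof (cases rule: bonus_sum_zero_cases)
  case (1 a b)
  then have "s i \<in> Inl ` strats G i" for i
    using supp[OF assms, of i] by (cases "i \<in> {p, q}") (auto simp: strats_H)
  then show ?thesis using that(1) by blast
next
  case (2 x k l)
  then have "x \<in> X" "k < 3" "l < 3"
    using supp[OF assms, of p] supp[OF assms, of q] by (auto simp: strats_H)
  moreover have "s i \<in> Inl ` strats G i" if "i \<notin> {p, q}" for i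
    using supp[OF assms, of i] that by (auto simp: strats_H)
  ultimately show ?thesis using that(2) 2 by blast
qed

text \<open>If the opponent never played the successor, the bonus would be -1 throughout the
  recommendation \<open>(x, k)\<close>, although its mean there is 0.\<close>

lemma supp_successor:
  assumes "i \<in> {p, q}" "s \<in> set_pmf \<mu>" "s i = Inr (x, k)"
  shows "\<exists>t\<in>set_pmf \<mu>. t (opp i) = Inr (x, Suc k mod 3)"
proof (rule ccontr)
  assume no: "\<not> ?thesis"
  have "of_bool (s i = Inr (x, k)) * own_bonus i s = 0"
  proof (rule expect_zero_nonpos[OF finite_supp expect_bonus_zero])
    show "Inr (x, k) \<in> strats H i"
      using supp[OF assms(2), of i] assms(3) by simp
    show "of_bool (t i = Inr (x, k)) * own_bonus i t \<le> 0" if "t \<in> set_pmf \<mu>" for t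
      using no that by (auto simp: own_bonus_def bonus_Inr)
  qed (use assms in auto)
  then show False
    using assms(3) by (simp add: own_bonus_def bonus_Inr split: if_splits)
qed

text \<open>This is what lets the block parts be removed from the incentive constraints of the other
  players.\<close>

lemma third_player_indifferent:
  assumes "s \<in> set_pmf \<mu>" "s p = Inr z" "s i = Inl a" "b \<in> strats H i"
  shows "payoff H i (s(i := b)) = payoff H i s"
  using assms(1)
proof (cases rule: supp_cases)
  case 1
  then show ?thesis using assms(2) by (metis Inl_Inr_False imageE)
next
  case (2 x k l)
  then have i: "i \<notin> {p, q}" using assms by auto
  then obtain b' where "b = Inl b'" using assms(4) by (auto simp: strats_H)
  then show ?thesis
    using i assms by (auto simp: payoff_H base_def own_bonus_def opp_def)
qed

section \<open>Conditioning a correlated equilibrium on the block in play\<close>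

definition label :: "('n \<Rightarrow> 'a + (real ^ 'n) \<times> nat) \<Rightarrow> (real ^ 'n) option" where
  "label s = (case s p of Inl _ \<Rightarrow> None | Inr (x, _) \<Rightarrow> Some x)"

text \<open>Looking at \<open>p\<close> alone suffices: on the support, \<open>q\<close> is in the
  same block or, like \<open>p\<close>, in the original game.\<close>

abbreviation part :: "(real ^ 'n) option \<Rightarrow> ('n \<Rightarrow> 'a + (real ^ 'n) \<times> nat) pmf" where
  "part c \<equiv> cond_pmf \<mu> (label -` {c})"

lemma expect_part:
  assumes "c \<in> label ` set_pmf \<mu>"
  shows "measure_pmf.prob \<mu> (label -` {c}) * expect (part c) f = expect \<mu> (\<lambda>s. of_bool (label s = c) * f s)"
  using assms expect_cond_pmf[OF finite_supp, of "label -` {c}" f] by auto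

lemma prob_part_pos: "c \<in> label ` set_pmf \<mu> \<Longrightarrow> 0 < measure_pmf.prob \<mu> (label -` {c})"
  by (auto intro: measure_pmf_posI)

lemma set_part: "c \<in> label ` set_pmf \<mu> \<Longrightarrow> set_pmf (part c) = {s \<in> set_pmf \<mu>. label s = c}"
  by (subst set_cond_pmf) auto

lemma set_part_profiles: "c \<in> label ` set_pmf \<mu> \<Longrightarrow> set_pmf (part c) \<subseteq> profiles H"
  using supp by (auto simp: set_part mem_profiles)

lemma expect_label_sum:
  "(\<Sum>c\<in>label ` set_pmf \<mu>. measure_pmf.prob \<mu> (label -` {c}) * expect (part c) f) = expect \<mu> f"
proof -
  have "expect \<mu> f = expect \<mu> (\<lambda>s. \<Sum>c\<in>label ` set_pmf \<mu>. of_bool (label s = c) * f s)"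
    using finite_supp
    by (intro expect_cong) (simp add: of_bool_def if_distrib[of "\<lambda>x. x * _"] cong: if_cong)
  then show ?thesis
    by (simp add: expect_sum[OF finite_supp] expect_part)
qed

text \<open>For an original recommendation, profiles with a block contribute gain 0, so conditioning
  them away only rescales the constraint; for a block recommendation the gain vanishes on this
  part.\<close>

lemma payoff_vec_part_None:
  assumes "None \<in> label ` set_pmf \<mu>"
  shows "payoff_vec H (part None) \<in> CEP G"
proof (rule CEP_preimage)
  have Inl: "s i \<in> Inl ` strats G i" if "s \<in> set_pmf \<mu>" "label s = None" for s i
    using that(1) by (cases rule: supp_cases) (use that(2) in \<open>auto simp: label_def\<close>)
  then show "set_pmf (part None) \<subseteq> {s. \<forall>i. s i \<in> Inl ` strats G i}"
    using assms by (auto simp: set_part)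
  have "0 \<le> expect (part None) (gain H i a b)" if ab: "a \<in> strats H i" "b \<in> strats H i" for i a b
  proof -
    have "0 \<le> expect \<mu> (\<lambda>s. of_bool (label s = None) * gain H i a b s)"
    proof (cases a)
      case (Inl a')
      have "expect \<mu> (\<lambda>s. of_bool (label s = None) * gain H i a b s) = expect \<mu> (gain H i a b)"
      proof (rule expect_cong)
        fix s assume s: "s \<in> set_pmf \<mu>"
        show "of_bool (label s = None) * gain H i a b s = gain H i a b s"
        proof (cases "s i = a \<and> label s \<noteq> None")
          case True
          then obtain z where "s p = Inr z"
            by (auto simp: label_def split: sum.splits)
          then show ?thesis
            using third_player_indifferent[OF s _ _ ab(2)] True Inl by (simp add: gain_def)
        qed (auto simp: gain_def)
      qed
      then show ?thesis
        using CE ab unfolding correlated_eq_iff[OF finite_game_H] by auto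
    next
      case (Inr z)
      have "expect \<mu> (\<lambda>s. of_bool (label s = None) * gain H i a b s) = expect \<mu> (\<lambda>_. 0)"
      proof (rule expect_cong)
        fix s assume "s \<in> set_pmf \<mu>"
        then have "\<not> (label s = None \<and> s i = a)"
          using Inl[of s i] Inr by auto
        then show "of_bool (label s = None) * gain H i a b s = 0"
          by (auto simp: gain_def)
      qed
      then show ?thesis by simp
    qed
    then show ?thesis
      unfolding expect_part[OF assms, symmetric] using prob_part_pos[OF assms]
      by (simp add: zero_le_mult_iff)
  qed
  then show "correlated_eq H (part None)"
    using set_part_profiles[OF assms] by (simp add: correlated_eq_iff[OF finite_game_H])
qed

lemma payoff_vec_part_Some:
  assumes x: "Some x \<in> label ` set_pmf \<mu>"
  shows "x \<in> X" "payoff_vec H (part (Some x)) = x"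
proof -
  have block: "x \<in> X \<and> (\<exists>k l. k < 3 \<and> l < 3 \<and> s p = Inr (x, k) \<and> s q = Inr (x, l)) \<and>
      (\<forall>i. i \<notin> {p, q} \<longrightarrow> s i \<in> Inl ` strats G i)"
    if "s \<in> set_pmf \<mu>" "label s = Some x" for s
    using that(1)
  proof (cases rule: supp_cases)
    case 1
    from this[of p] show ?thesis using that(2) by (auto simp: label_def)
  next
    case (2 y k l)
    then show ?thesis using that(2) by (auto simp: label_def)
  qed
  then show "x \<in> X" using x by force
  \<comment> \<open>For \<open>p\<close> and \<open>q\<close> the event splits into the three
    recommendations \<open>(x, k)\<close>, on each of which the bonus averages to 0.\<close>
  have zero: "expect \<mu> (\<lambda>s. of_bool (label s = Some x) * own_bonus i s) = 0" for i
  proof (cases "i \<in> {p, q}")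
    case True
    have "expect \<mu> (\<lambda>s. of_bool (label s = Some x) * own_bonus i s)
        = expect \<mu> (\<lambda>s. \<Sum>k<3. of_bool (s i = Inr (x, k)) * own_bonus i s)"
    proof (rule expect_cong)
      fix s assume s: "s \<in> set_pmf \<mu>"
      show "of_bool (label s = Some x) * own_bonus i s = (\<Sum>k<3. of_bool (s i = Inr (x, k)) * own_bonus i s)"
      proof (cases "label s = Some x")
        case True
        then obtain k where k: "k < 3" "s i = Inr (x, k)"
          using block[OF s] \<open>i \<in> {p, q}\<close> by blast
        have "(\<Sum>k'<3. of_bool (s i = Inr (x, k')) * own_bonus i s) = (\<Sum>k'<3. if k = k' then own_bonus i s else 0)"
          using k by (intro sum.cong) auto
        then show ?thesis
          using True k by simp
      next
        case False
        have "s i \<noteq> Inr (x, k)" for k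
          using s by (cases rule: supp_cases)
            (use False True in \<open>auto simp: label_def, metis Inl_Inr_False imageE\<close>)
        then show ?thesis using False by simp
      qed
    qed
    also have "\<dots> = (\<Sum>k<3. expect \<mu> (\<lambda>s. of_bool (s i = Inr (x, k)) * own_bonus i s))"
      by (rule expect_sum[OF finite_supp])
    also have "\<dots> = 0"
      using True \<open>x \<in> X\<close> by (intro sum.neutral ballI expect_bonus_zero) (auto simp: strats_H)
    finally show ?thesis .
  next
    case False
    have "expect \<mu> (\<lambda>s. of_bool (label s = Some x) * own_bonus i s) = expect \<mu> (\<lambda>_. 0)"
      using block False by (intro expect_cong) (fastforce simp: own_bonus_def)
    then show ?thesis by simp
  qed
  have "expect (part (Some x)) (payoff H i) = x $ i" for i
  proof -
    let ?p = "measure_pmf.prob \<mu> (label -` {Some x})"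
    have "?p * expect (part (Some x)) (payoff H i)
        = expect \<mu> (\<lambda>s. of_bool (label s = Some x) * x $ i + of_bool (label s = Some x) * own_bonus i s)"
      unfolding expect_part[OF x]
    proof (rule expect_cong)
      fix s assume s: "s \<in> set_pmf \<mu>"
      show "of_bool (label s = Some x) * payoff H i s
          = of_bool (label s = Some x) * x $ i + of_bool (label s = Some x) * own_bonus i s"
        using block[OF s] by (auto simp: payoff_H base_def opp_def)
    qed
    also have "\<dots> = ?p * expect (part (Some x)) (\<lambda>_. x $ i)"
      unfolding expect_add[OF finite_supp] zero expect_part[OF x] by simp
    finally show ?thesis
      using prob_part_pos[OF x] by simp
  qed
  then show "payoff_vec H (part (Some x)) = x"
    by (simp add: payoff_vec_def exp_payoff_eq[OF finite_game_H set_part_profiles[OF x]])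
qed

text \<open>The payoff vector is the average of those of the parts, weighted by the label
  probabilities, and each of them lies in \<open>CEP G\<close> or in \<open>X\<close>.\<close>

lemma payoff_vec_mem:
  assumes P: "convex P" "X \<subseteq> P" "CEP G \<subseteq> P"
  shows "payoff_vec H \<mu> \<in> P"
proof -
  let ?w = "\<lambda>c. measure_pmf.prob \<mu> (label -` {c})"
  have "(\<Sum>c\<in>label ` set_pmf \<mu>. ?w c *\<^sub>R payoff_vec H (part c)) \<in> P"
  proof (rule convex_sum[OF _ P(1)])
    show "(\<Sum>c\<in>label ` set_pmf \<mu>. ?w c) = 1"
      using expect_label_sum[of "\<lambda>_. 1"] by simp
    fix c assume c: "c \<in> label ` set_pmf \<mu>"
    show "payoff_vec H (part c) \<in> P"
      using c payoff_vec_part_None payoff_vec_part_Some[of "the c"] P by (cases c) auto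
  qed (use finite_supp in auto)
  also have "(\<Sum>c\<in>label ` set_pmf \<mu>. ?w c *\<^sub>R payoff_vec H (part c)) = payoff_vec H \<mu>"
  proof -
    have "set_pmf \<mu> \<subseteq> profiles H"
      using CE by (simp add: correlated_eq_def)
    then show ?thesis
      using expect_label_sum
      by (simp add: vec_eq_iff payoff_vec_def exp_payoff_eq[OF finite_game_H] set_part_profiles)
  qed
  finally show ?thesis .
qed

end

lemma supp_nash:
  assumes CE: "correlated_eq H (induced_dist \<sigma>)"
  shows "set_pmf (\<sigma> i) \<subseteq> Inl ` strats G i"
proof
  fix c assume c: "c \<in> set_pmf (\<sigma> i)"
  have "mixed_profile H \<sigma>"
    using CE by (simp add: correlated_eq_def set_induced_dist_profiles)
  then have c_strat: "c \<in> strats H i"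
    using c by (auto simp: mixed_profile_def)
  have "\<forall>j. \<exists>b. b \<in> set_pmf (\<sigma> j)"
    using set_pmf_not_empty by (metis ex_in_conv)
  then obtain t where t: "\<And>j. t j \<in> set_pmf (\<sigma> j)"
    by metis
  \<comment> \<open>In a product distribution any supported strategy of \<open>j\<close> can be
    grafted onto the supported profile \<open>t\<close>.\<close>
  have succ: "Inr (x, Suc k mod 3) \<in> set_pmf (\<sigma> (opp j))"
    if "j \<in> {p, q}" "Inr (x, k) \<in> set_pmf (\<sigma> j)" for j x k
  proof -
    have "t(j := Inr (x, k)) \<in> set_pmf (induced_dist \<sigma>)"
      using t that by (simp add: set_induced_dist)
    from supp_successor[OF CE that(1) this, of x k] show ?thesis
      by (auto simp: set_induced_dist) metis
  qed
  have "\<not> (i \<in> {p, q} \<and> c \<in> Inr ` (X \<times> {..<3}))"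
  proof
    assume "i \<in> {p, q} \<and> c \<in> Inr ` (X \<times> {..<3})"
    then obtain x k where i: "i \<in> {p, q}" and k: "k < 3" "c = Inr (x, k)"
      by auto
    \<comment> \<open>Three alternating steps end at the opponent, since 3 is odd, and return to
      \<open>k\<close>; then both can play \<open>c\<close>, a tie of total bonus -2.\<close>
    have "Inr (x, Suc (Suc (Suc k mod 3) mod 3) mod 3) \<in> set_pmf (\<sigma> (opp i))"
      using succ[OF i] succ[OF opp_mem] opp_opp[OF i] c k(2) i by metis
    moreover have "Suc (Suc (Suc k mod 3) mod 3) mod 3 = k"
      using k(1) by presburger
    ultimately have "t(i := c, opp i := c) \<in> set_pmf (induced_dist \<sigma>)"
      using t c k by (simp add: set_induced_dist)
    from bonus_sum_zero[OF CE this] show False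
      using i k pq by (auto simp: opp_def bonus_same)
  qed
  then show "c \<in> Inl ` strats G i"
    using c_strat by (auto simp: strats_H split: if_splits)
qed

text \<open>Given the recommendation \<open>(x, k)\<close>, the opponent is uniform on the other two
  strategies of the block. Obedience wins against one and loses to the other, for a mean bonus of
  0.\<close>

lemma vertex_mem_CEP:
  assumes x: "x \<in> X"
  shows "x \<in> CEP H"
proof -
  define block :: "nat \<times> nat \<Rightarrow> 'n \<Rightarrow> 'a + (real ^ 'n) \<times> nat" where
    "block = (\<lambda>(k, l) j. if j = p then Inr (x, k) else if j = q then Inr (x, l) else Inl (e j))"
  define D :: "(nat \<times> nat) set" where "D = {(0, 1), (0, 2), (1, 0), (1, 2), (2, 0), (2, 1)}"
  define \<mu> where "\<mu> = map_pmf block (pmf_of_set D)"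
  have D: "D \<noteq> {}" "finite D" by (auto simp: D_def)
  have E: "expect \<mu> f = (f (block (0, 1)) + f (block (0, 2)) + f (block (1, 0)) + f (block (1, 2))
      + f (block (2, 0)) + f (block (2, 1))) / 6" for f
    unfolding \<mu>_def integral_map_pmf integral_pmf_of_set[OF D] by (simp add: D_def)
  have block_simps: "block (k, l) p = Inr (x, k)" "block (k, l) q = Inr (x, l)"
    "i \<notin> {p, q} \<Longrightarrow> block (k, l) i = Inl (e i)" for k l i
    using pq by (auto simp: block_def)
  have opp_simps: "opp p = q" "opp q = p" "i \<notin> {p, q} \<Longrightarrow> opp i = p" for i
    using pq by (auto simp: opp_def)
  have sub: "set_pmf \<mu> \<subseteq> profiles H"
    using D x e by (auto simp: \<mu>_def mem_profiles strats_H block_def D_def)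
  have base: "base i (block (k, l)) = x $ i" "base i ((block (k, l))(i := d)) = x $ i" for i k l d
    using pq by (auto simp: base_def opp_def block_def)
  have "expect \<mu> (payoff H i) = x $ i" for i
  proof -
    consider "i = p" | "i = q" | "i \<notin> {p, q}" by blast
    then show ?thesis
      by cases (simp_all add: E payoff_H base own_bonus_def block_simps opp_simps bonus_Inr)
  qed
  then have "payoff_vec H \<mu> = x"
    by (simp add: payoff_vec_def exp_payoff_eq[OF finite_game_H sub])
  moreover have "0 \<le> expect \<mu> (gain H i c d)" if cd: "c \<in> strats H i" "d \<in> strats H i" for i c d
  proof -
    \<comment> \<open>A strategy wins against at most one opposing strategy, so no deviation beats a
      mean bonus of 0. The three instances used below are the pairs left after removing the
      recommended one.\<close>
    have dev: "bonus d (Inr (x, l)) + bonus d (Inr (x, l')) \<le> 0" if "l \<noteq> l'" for l l'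
      using that by (cases d) (auto simp: bonus_Inr)
    consider "i = p" | "i = q" | "i \<notin> {p, q}" by blast
    then show ?thesis
    proof cases
      case 3
      then obtain d' where "d = Inl d'" using cd by (auto simp: strats_H)
      then show ?thesis
        using 3 by (simp add: E gain_def payoff_H base own_bonus_def block_simps opp_simps)
    next
      case 1
      then show ?thesis
        using dev[of 0 1] dev[of 0 2] dev[of 1 2] pq
        by (cases c) (auto simp: E gain_def payoff_H base own_bonus_def block_simps opp_simps bonus_Inr)
    next
      case 2
      then show ?thesis
        using dev[of 0 1] dev[of 0 2] dev[of 1 2] pq
        by (cases c) (auto simp: E gain_def payoff_H base own_bonus_def block_simps opp_simps bonus_Inr)
    qed
  qed
  then have "correlated_eq H \<mu>"
    using sub by (simp add: correlated_eq_iff[OF finite_game_H])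
  ultimately show ?thesis
    unfolding CEP_def by blast
qed

lemma NEP_H: "NEP H = NEP G"
  using NEP_eqI supp_nash by blast

lemma CEP_H:
  assumes "CEP G \<subseteq> convex hull X"
  shows "CEP H = convex hull X"
proof
  show "CEP H \<subseteq> convex hull X"
    using payoff_vec_mem[OF _ convex_convex_hull hull_subset assms] by (auto simp: CEP_def)
  show "convex hull X \<subseteq> CEP H"
    using vertex_mem_CEP convex_CEP[OF finite_game_H] by (intro hull_minimal) auto
qed

end

theorem proposition4:
  fixes G :: "('n::finite, 'a) game" and P :: "(real ^ 'n) set"
  assumes "CARD('n) \<ge> 2"
    and "finite_game G"
    and "polytope P"
    and "CEP G \<subseteq> P"
  shows "\<exists>G' :: ('n, nat) game. finite_game G' \<and> NEP G' = NEP G \<and> CEP G' = P"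
proof -
  obtain X where X: "finite X" "P = convex hull X"
    using assms(3) by (auto simp: polytope_def)
  \<comment> \<open>The hypothesis on the number of players enters here: the blocks need two
    distinct controllers.\<close>
  obtain p q :: 'n where "p \<noteq> q"
    using assms(1) card_le_Suc0_iff_eq[of "UNIV :: 'n set"] by force
  moreover have "\<forall>i. \<exists>a. a \<in> strats G i"
    using assms(2) by (auto simp: finite_game_def)
  then obtain e where "\<And>i. e i \<in> strats G i"
    by metis
  ultimately interpret block_extension G p q e X
    using assms(2) X by unfold_locales
  show ?thesis
    using ex_nat_game[OF finite_game_H] NEP_H CEP_H assms(4) X(2) by metis
qed

end
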